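(* Suppose $\psi(M_1)=0$ and put $\eta_1=\psi(L_1)$, $\eta_2=\psi(L_2)$, $\eta_3=\psi(Y_{\frac12})$. Define $z\in U(\mathfrak{sv})$ by: $z=L_0$ if $\eta_1=\eta_2=\eta_3=0$; $$z=L_0M_0^2-\eta_2M_{-2}M_0-\eta_1M_{-1}M_0+\eta_2M_{-1}^2-\frac{\eta_3}{2}Y_{-\frac12}M_0+\frac{\eta_3^2}{2}M_{-1}$$ if $\eta_2\neq 0$ or $\eta_3\neq 0$; and $z=L_0M_0-\eta_1M_{-1}$ otherwise (i.e. $\eta_2=\eta_3=0$, $\eta_1\neq0$). Then for every $u\in\mathbb{C}[z,M_0]$, the vector $v=uw$ is a Whittaker vector of $W_\psi$, where $w=1\otimes1$; that is, $xv=\psi(x)v$ for all $x\in\mathfrak{sv}^+$.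
   Context: The Schrödinger-Virasoro algebra $\mathfrak{sv}$ is the complex Lie algebra with basis $\{L_n,M_n,Y_{n+\frac12}\mid n\in\mathbb{Z}\}$ and brackets, for $m,n\in\mathbb{Z}$: $[L_m,L_n]=(n-m)L_{m+n}$, $[L_m,M_n]=nM_{m+n}$, $[L_m,Y_{n+\frac12}]=(n+\frac{1-m}{2})Y_{m+n+\frac12}$, $[Y_{m+\frac12},Y_{n+\frac12}]=(n-m)M_{m+n+1}$, $[M_m,M_n]=[M_m,Y_{n+\frac12}]=0$. The element $M_0$ is central. Put $\mathfrak{sv}^+=\mathrm{span}_{\mathbb{C}}\{L_n,M_n,Y_{m+\frac12}\mid n\geq 1,\ m\geq 0\}$. Let $\psi:\mathfrak{sv}^+\to\mathbb{C}$ be a Lie algebra homomorphism; throughout, $\psi(L_n)=0$ for $n\geq 3$, $\psi(M_m)=0$ for $m\geq 2$, and $\psi(Y_{\frac12+k})=0$ for $k\geq 1$. Let $\mathbb{C}_\psi$ be the one-dimensional $\mathfrak{sv}^+$-module with $x\alpha=\psi(x)\alpha$, and let $W_\psi=U(\mathfrak{sv})\otimes_{U(\mathfrak{sv}^+)}\mathbb{C}_\psi$. $\mathbb{C}[z,M_0]$ denotes the subalgebra of $U(\mathfrak{sv})$ generated by $z$ and $M_0$. *)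

theory Defs
  imports Complex_Main "HOL-Library.Poly_Mapping" "HOL-Computational_Algebra.Group_Closure"
begin

section \<open>Complex vector spaces, Lie algebras and associative algebras\<close>

class cvec = ab_group_add +
  fixes cscale :: "complex \<Rightarrow> 'a \<Rightarrow> 'a"  (infixr \<open>*\<^sub>c\<close> 75)
  assumes cscale_add_right: "c *\<^sub>c (x + y) = c *\<^sub>c x + c *\<^sub>c y"
    and cscale_add_left: "(c + d) *\<^sub>c x = c *\<^sub>c x + d *\<^sub>c x"
    and cscale_cscale: "c *\<^sub>c d *\<^sub>c x = (c * d) *\<^sub>c x"
    and cscale_one: "1 *\<^sub>c x = x"

global_interpretation cvec: vector_space "cscale :: complex \<Rightarrow> 'a \<Rightarrow> 'a::cvec"
  by unfold_locales
    (simp_all add: cscale_add_right cscale_add_left cscale_cscale cscale_one)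

class clie = cvec +
  fixes bracket :: "'a \<Rightarrow> 'a \<Rightarrow> 'a"
  assumes bracket_add_left: "bracket (x + y) z = bracket x z + bracket y z"
    and bracket_add_right: "bracket x (y + z) = bracket x y + bracket x z"
    and bracket_scale_left: "bracket (c *\<^sub>c x) y = c *\<^sub>c bracket x y"
    and bracket_scale_right: "bracket x (c *\<^sub>c y) = c *\<^sub>c bracket x y"
    and bracket_self: "bracket x x = 0"
    and jacobi: "bracket x (bracket y z) + bracket y (bracket z x) + bracket z (bracket x y) = 0"

class calg = cvec + ring_1 +
  assumes cscale_mult_left: "(c *\<^sub>c x) * y = c *\<^sub>c (x * y)"
    and cscale_mult_right: "x * (c *\<^sub>c y) = c *\<^sub>c (x * y)"

definition lie_hom :: "('g::clie \<Rightarrow> 'h::clie) \<Rightarrow> bool" where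
  "lie_hom f \<longleftrightarrow> Vector_Spaces.linear cscale cscale f \<and>
     (\<forall>x y. f (bracket x y) = bracket (f x) (f y))"

text \<open>Homomorphisms from a Lie algebra to an associative algebra with its commutator bracket.\<close>

definition lie_alg_hom :: "('g::clie \<Rightarrow> 'a::calg) \<Rightarrow> bool" where
  "lie_alg_hom f \<longleftrightarrow> Vector_Spaces.linear cscale cscale f \<and>
     (\<forall>x y. f (bracket x y) = f x * f y - f y * f x)"

inductive_set subalgebra_generated :: "'a::calg set \<Rightarrow> 'a set" for S where
  gen: "x \<in> S \<Longrightarrow> x \<in> subalgebra_generated S"
| one: "1 \<in> subalgebra_generated S"
| add: "x \<in> subalgebra_generated S \<Longrightarrow> y \<in> subalgebra_generated S \<Longrightarrow> x + y \<in> subalgebra_generated S"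
| scale: "x \<in> subalgebra_generated S \<Longrightarrow> c *\<^sub>c x \<in> subalgebra_generated S"
| mult: "x \<in> subalgebra_generated S \<Longrightarrow> y \<in> subalgebra_generated S \<Longrightarrow> x * y \<in> subalgebra_generated S"

text \<open>The one-dimensional space of complex numbers is an associative algebra and an abelian
  Lie algebra.\<close>

instantiation complex :: clie
begin

definition "cscale_complex = ((*) :: complex \<Rightarrow> complex \<Rightarrow> complex)"

definition "bracket_complex (x::complex) (y::complex) = (0::complex)"

instance
  by standard (simp_all add: cscale_complex_def bracket_complex_def algebra_simps)

end

instance complex :: calg
  by standard (simp_all add: cscale_complex_def)

lemma lie_alg_hom_character: "lie_hom \<psi> \<Longrightarrow> lie_alg_hom \<psi>" for \<psi> :: "'g::clie \<Rightarrow> complex"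
  by (simp add: lie_hom_def lie_alg_hom_def bracket_complex_def)

definition lin_ext :: "('b \<Rightarrow> 'v::cvec) \<Rightarrow> ('b \<Rightarrow>\<^sub>0 complex) \<Rightarrow> 'v" where
  "lin_ext v p = (\<Sum>b\<in>Poly_Mapping.keys p. poly_mapping.lookup p b *\<^sub>c v b)"

lemma lin_ext_superset:
  "finite A \<Longrightarrow> Poly_Mapping.keys p \<subseteq> A \<Longrightarrow> lin_ext v p = (\<Sum>b\<in>A. poly_mapping.lookup p b *\<^sub>c v b)"
  unfolding lin_ext_def
  by (rule sum.mono_neutral_left) (auto simp: in_keys_iff)

lemma lin_ext_zero [simp]: "lin_ext v 0 = 0"
  by (simp add: lin_ext_def)

lemma lin_ext_single [simp]: "lin_ext v (Poly_Mapping.single b c) = c *\<^sub>c v b"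
  by (simp add: lin_ext_superset[of "{b}"])

lemma lin_ext_add: "lin_ext v (p + q) = lin_ext v p + lin_ext v q"
proof -
  let ?A = "Poly_Mapping.keys p \<union> Poly_Mapping.keys q"
  have "lin_ext v (p + q) = (\<Sum>b\<in>?A. poly_mapping.lookup (p + q) b *\<^sub>c v b)"
    by (rule lin_ext_superset) (use keys_add[of p q] in auto)
  also have "\<dots> = (\<Sum>b\<in>?A. poly_mapping.lookup p b *\<^sub>c v b) + (\<Sum>b\<in>?A. poly_mapping.lookup q b *\<^sub>c v b)"
    by (simp add: lookup_add cscale_add_left sum.distrib)
  finally show ?thesis
    by (simp add: lin_ext_superset[of ?A])
qed

lemma lin_ext_uminus: "lin_ext v (- p) = - lin_ext v p"
  using lin_ext_add[of v p "- p"] by (simp add: eq_neg_iff_add_eq_0 add.commute)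

lemma lin_ext_diff: "lin_ext v (p - q) = lin_ext v p - lin_ext v q"
  using lin_ext_add[of v p "- q"] by (simp add: lin_ext_uminus)

lemma lin_ext_map: "lin_ext v (Poly_Mapping.map ((*) c) p) = c *\<^sub>c lin_ext v p"
proof -
  have "Poly_Mapping.keys (Poly_Mapping.map ((*) c) p) \<subseteq> Poly_Mapping.keys p"
    by (auto simp: in_keys_iff Poly_Mapping.map.rep_eq)
  then have "lin_ext v (Poly_Mapping.map ((*) c) p)
      = (\<Sum>b\<in>Poly_Mapping.keys p. poly_mapping.lookup (Poly_Mapping.map ((*) c) p) b *\<^sub>c v b)"
    by (intro lin_ext_superset) auto
  also have "\<dots> = c *\<^sub>c lin_ext v p"
    by (auto simp: lin_ext_def cvec.scale_sum_right Poly_Mapping.map.rep_eq cscale_cscale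
        in_keys_iff intro!: sum.cong)
  finally show ?thesis .
qed

lemma lin_ext_fun_add: "lin_ext (\<lambda>b. v b + v' b) p = lin_ext v p + lin_ext v' p"
  by (simp add: lin_ext_def cscale_add_right sum.distrib)

lemma lin_ext_fun_scale: "lin_ext (\<lambda>b. c *\<^sub>c v b) p = c *\<^sub>c lin_ext v p"
  by (simp add: lin_ext_def cvec.scale_sum_right cscale_cscale mult.commute)

lemma poly_mapping_single_induct [case_names zero single_add]:
  assumes "P 0" and "\<And>k c p. P p \<Longrightarrow> P (Poly_Mapping.single k c + p)"
  shows "P p"
proof (induction p rule: update_induct)
  case const
  then show ?case by (rule assms(1))
next
  case (update f a b)
  have "Poly_Mapping.update a b f = Poly_Mapping.single a b + f"
    using update(1)
    by (intro poly_mapping_eqI)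
      (auto simp: lookup_update lookup_add lookup_single when_def not_in_keys_iff_lookup_eq_zero)
  with update show ?case by (simp add: assms(2))
qed

section \<open>The universal enveloping algebra\<close>

text \<open>Lists form the free monoid; it is written additively because the convolution product of
  \<^theory>\<open>HOL-Library.Poly_Mapping\<close> expects an additive monoid of exponents.  Hence
  \<^typ>\<open>'g list \<Rightarrow>\<^sub>0 complex\<close> is the free associative unital algebra on the set \<^typ>\<open>'g\<close>.\<close>

instantiation list :: (type) monoid_add
begin

definition "zero_list = []"

definition "plus_list = (@)"

instance
  by standard (simp_all add: zero_list_def plus_list_def)

end

definition word_gen :: "'g \<Rightarrow> 'g list \<Rightarrow>\<^sub>0 complex" where
  "word_gen x = Poly_Mapping.single [x] 1"

definition word_const :: "complex \<Rightarrow> 'g list \<Rightarrow>\<^sub>0 complex" where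
  "word_const c = Poly_Mapping.single [] c"

text \<open>The first two families of relators turn the free algebra on the set \<^typ>\<open>'g\<close> into the
  tensor algebra of the vector space \<^typ>\<open>'g\<close>.\<close>

definition uea_relators :: "('g::clie list \<Rightarrow>\<^sub>0 complex) set" where
  "uea_relators =
     {word_gen (x + y) - word_gen x - word_gen y |x y. True}
     \<union> {word_gen (c *\<^sub>c x) - word_const c * word_gen x |c x. True}
     \<union> {word_gen x * word_gen y - word_gen y * word_gen x - word_gen (bracket x y) |x y. True}"

definition uea_ideal :: "('g::clie list \<Rightarrow>\<^sub>0 complex) set" where
  "uea_ideal = group_closure {a * r * b |a r b. r \<in> uea_relators}"

definition uea_eq :: "('g::clie list \<Rightarrow>\<^sub>0 complex) \<Rightarrow> ('g list \<Rightarrow>\<^sub>0 complex) \<Rightarrow> bool" where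
  "uea_eq p q \<longleftrightarrow> p - q \<in> uea_ideal"

lemma uea_ideal_zero: "0 \<in> uea_ideal"
  and uea_ideal_add: "p \<in> uea_ideal \<Longrightarrow> q \<in> uea_ideal \<Longrightarrow> p + q \<in> uea_ideal"
  and uea_ideal_uminus: "p \<in> uea_ideal \<Longrightarrow> - p \<in> uea_ideal"
  unfolding uea_ideal_def by (simp_all add: group_closure_add)

lemma uea_ideal_mult: "p \<in> uea_ideal \<Longrightarrow> a * p * b \<in> uea_ideal"
  unfolding uea_ideal_def
proof (induction rule: group_closure.induct)
  case (base s)
  show ?case
  proof (cases "s = 0")
    case False
    with base obtain a' r b' where s: "s = a' * r * b'" and r: "r \<in> uea_relators"
      by auto
    have "a * s * b = (a * a') * r * (b' * b)"
      by (simp add: s mult.assoc)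
    with r show ?thesis
      by (intro group_closure.base) blast
  qed simp
next
  case (diff s t)
  then show ?case
    by (simp add: algebra_simps group_closure.diff)
qed

lemma uea_ideal_relator: "r \<in> uea_relators \<Longrightarrow> r \<in> uea_ideal"
  unfolding uea_ideal_def by (rule group_closure.base) (force intro: exI[of _ 1])

text \<open>The algebra homomorphism from the free algebra determined by the images of the generators.\<close>

definition word_eval :: "('g \<Rightarrow> 'a::calg) \<Rightarrow> ('g list \<Rightarrow>\<^sub>0 complex) \<Rightarrow> 'a" where
  "word_eval f = lin_ext (\<lambda>xs. prod_list (map f xs))"

lemma word_eval_add: "word_eval f (p + q) = word_eval f p + word_eval f q"
  and word_eval_diff: "word_eval f (p - q) = word_eval f p - word_eval f q"
  by (simp_all add: word_eval_def lin_ext_add lin_ext_diff)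

lemma word_eval_zero [simp]: "word_eval f 0 = 0"
  by (simp add: word_eval_def)

lemma word_eval_one [simp]: "word_eval f 1 = 1"
proof -
  have "word_eval f (Poly_Mapping.single 0 1) = 1"
    by (simp add: word_eval_def zero_list_def cscale_one del: single_one)
  then show ?thesis by simp
qed

lemma word_eval_gen [simp]: "word_eval f (word_gen x) = f x"
  by (simp add: word_eval_def word_gen_def cscale_one)

lemma word_eval_const [simp]: "word_eval f (word_const c) = c *\<^sub>c 1"
  by (simp add: word_eval_def word_const_def)

lemma word_eval_mult: "word_eval f (p * q) = word_eval f p * word_eval f q"
proof (induction p rule: poly_mapping_single_induct)
  case (single_add k c p)
  have "word_eval f (Poly_Mapping.single k c * q)
      = word_eval f (Poly_Mapping.single k c) * word_eval f q"
  proof (induction q rule: poly_mapping_single_induct)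
    case (single_add l d q)
    then show ?case
      by (simp add: word_eval_add distrib_left mult_single)
        (simp add: word_eval_def plus_list_def cscale_mult_left cscale_mult_right cscale_cscale
          mult.commute)
  qed simp
  with single_add show ?case
    by (simp add: word_eval_add distrib_right)
qed simp

lemma word_eval_ideal:
  assumes f: "lie_alg_hom f" and "p \<in> uea_ideal"
  shows "word_eval f p = 0"
  using assms(2) unfolding uea_ideal_def
proof (induction rule: group_closure.induct)
  case (base s)
  have *: "f (x + y) = f x + f y" "f (c *\<^sub>c x) = c *\<^sub>c f x"
    "f (bracket x y) = f x * f y - f y * f x" for x y c
    using f by (simp_all add: lie_alg_hom_def linear_iff_module_hom module_hom_iff)
  have "word_eval f r = 0" if "r \<in> uea_relators" for r
    using that by (auto simp: uea_relators_def word_eval_diff word_eval_mult * cscale_mult_left)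
  with base show ?case
    by (auto simp: word_eval_mult)
next
  case (diff s t)
  then show ?case by (simp add: word_eval_diff)
qed

lemma equivp_uea_eq: "equivp uea_eq"
proof (rule equivpI)
  show "reflp uea_eq"
    by (simp add: reflp_def uea_eq_def uea_ideal_zero)
  show "symp uea_eq"
    unfolding symp_def uea_eq_def using uea_ideal_uminus by fastforce
  show "transp uea_eq"
    unfolding transp_def uea_eq_def using uea_ideal_add by fastforce
qed

quotient_type (overloaded) 'g uea = "'g::clie list \<Rightarrow>\<^sub>0 complex" / uea_eq
  by (rule equivp_uea_eq)

instantiation uea :: (clie) calg
begin

lift_definition zero_uea :: "'a uea" is 0 .

lift_definition one_uea :: "'a uea" is 1 .

lift_definition plus_uea :: "'a uea \<Rightarrow> 'a uea \<Rightarrow> 'a uea" is "(+)"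
  unfolding uea_eq_def by (metis add_diff_add uea_ideal_add)

lift_definition uminus_uea :: "'a uea \<Rightarrow> 'a uea" is uminus
  unfolding uea_eq_def by (metis minus_diff_minus uea_ideal_uminus)

lift_definition minus_uea :: "'a uea \<Rightarrow> 'a uea \<Rightarrow> 'a uea" is "(-)"
proof -
  fix p p' q q' :: "'a list \<Rightarrow>\<^sub>0 complex"
  assume "uea_eq p p'" "uea_eq q q'"
  then have "(p - p') + - (q - q') \<in> uea_ideal"
    unfolding uea_eq_def by (intro uea_ideal_add uea_ideal_uminus)
  then show "uea_eq (p - q) (p' - q')"
    by (simp add: uea_eq_def algebra_simps)
qed

lift_definition times_uea :: "'a uea \<Rightarrow> 'a uea \<Rightarrow> 'a uea" is "(*)"
proof -
  fix p p' q q' :: "'a list \<Rightarrow>\<^sub>0 complex"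
  assume "uea_eq p p'" "uea_eq q q'"
  then have "1 * (p - p') * q + p' * (q - q') * 1 \<in> uea_ideal"
    unfolding uea_eq_def by (intro uea_ideal_add uea_ideal_mult)
  then show "uea_eq (p * q) (p' * q')"
    by (simp add: uea_eq_def algebra_simps)
qed

lift_definition cscale_uea :: "complex \<Rightarrow> 'a uea \<Rightarrow> 'a uea" is "\<lambda>c p. word_const c * p"
  unfolding uea_eq_def using uea_ideal_mult[where b = 1] by (metis mult.right_neutral right_diff_distrib)

lemma word_const_central: "word_const c * p = p * word_const c"
proof (induction p rule: poly_mapping_single_induct)
  case (single_add k d p)
  then show ?case
    by (simp add: algebra_simps word_const_def mult_single plus_list_def mult.commute)
qed simp

instance
proof
  fix x y z :: "'a uea" and c d :: complex
  have eq: "uea_eq p q" if "p = q" for p q :: "'a list \<Rightarrow>\<^sub>0 complex"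
    using that by (simp add: uea_eq_def uea_ideal_zero)
  have const: "word_const c * word_const d = (word_const (c * d) :: 'a list \<Rightarrow>\<^sub>0 complex)"
    "word_const (c + d) = (word_const c + word_const d :: 'a list \<Rightarrow>\<^sub>0 complex)"
    "word_const 1 = (1 :: 'a list \<Rightarrow>\<^sub>0 complex)" for c d
    by (simp_all add: word_const_def mult_single plus_list_def single_add)
      (simp flip: zero_list_def)
  show "x + y + z = x + (y + z)" by transfer (auto intro: eq simp: algebra_simps)
  show "x + y = y + x" by transfer (auto intro: eq simp: algebra_simps)
  show "0 + x = x" by transfer (auto intro: eq)
  show "- x + x = 0" by transfer (auto intro: eq)
  show "x - y = x + - y" by transfer (auto intro: eq)
  show "x * y * z = x * (y * z)" by transfer (auto intro: eq simp: mult.assoc)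
  show "1 * x = x" by transfer (auto intro: eq)
  show "x * 1 = x" by transfer (auto intro: eq)
  show "(x + y) * z = x * z + y * z" by transfer (auto intro: eq simp: algebra_simps)
  show "x * (y + z) = x * y + x * z" by transfer (auto intro: eq simp: algebra_simps)
  show "c *\<^sub>c (x + y) = c *\<^sub>c x + c *\<^sub>c y" by transfer (auto intro: eq simp: algebra_simps)
  show "(c + d) *\<^sub>c x = c *\<^sub>c x + d *\<^sub>c x"
    by transfer (auto intro: eq simp: algebra_simps const)
  show "c *\<^sub>c d *\<^sub>c x = (c * d) *\<^sub>c x"
    by transfer (auto intro: eq simp: const simp flip: mult.assoc)
  show "1 *\<^sub>c x = x" by transfer (auto intro: eq simp: const)
  show "(c *\<^sub>c x) * y = c *\<^sub>c (x * y)" by transfer (auto intro: eq simp: mult.assoc)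
  show "x * (c *\<^sub>c y) = c *\<^sub>c (x * y)"
    by transfer (metis eq mult.assoc word_const_central)
  show "(0 :: 'a uea) \<noteq> 1"
  proof transfer
    have hom: "lie_alg_hom (\<lambda>_::'a. 0 :: complex)"
      by (simp add: lie_alg_hom_def linear_iff_module_hom module_hom_iff cvec.module_axioms)
    show "\<not> uea_eq (0 :: 'a list \<Rightarrow>\<^sub>0 complex) 1"
      using word_eval_ideal[OF hom, of "0 - 1"]
        word_eval_diff[of "\<lambda>_::'a. 0 :: complex" 0 1] by (auto simp: uea_eq_def)
  qed
qed

end

lift_definition uea_of :: "'g::clie \<Rightarrow> 'g uea" is word_gen .

text \<open>The extension of a map to the enveloping algebra, meaningful for \<^const>\<open>lie_alg_hom\<close>; only
  then is it independent of the representative.\<close>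

definition uea_lift :: "('g::clie \<Rightarrow> 'a::calg) \<Rightarrow> 'g uea \<Rightarrow> 'a" where
  "uea_lift f u = word_eval f (rep_uea u)"

lemma uea_lift_abs:
  assumes "lie_alg_hom f"
  shows "uea_lift f (abs_uea p) = word_eval f p"
proof -
  have "uea_eq (rep_uea (abs_uea p)) p"
    using Quotient3_uea by (rule rep_abs_rsp_left) (simp add: uea_eq_def uea_ideal_zero)
  then show ?thesis
    using word_eval_ideal[OF assms] by (fastforce simp: uea_lift_def uea_eq_def word_eval_diff)
qed

lemma uea_lift_of:
  assumes "lie_alg_hom f"
  shows "uea_lift f (uea_of x) = f x"
  using assms by (simp add: uea_of.abs_eq uea_lift_abs)

lemma uea_lift_hom:
  assumes "lie_alg_hom f"
  shows "uea_lift f 1 = 1"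
    and "uea_lift f (u + v) = uea_lift f u + uea_lift f v"
    and "uea_lift f (u * v) = uea_lift f u * uea_lift f v"
    and "uea_lift f (c *\<^sub>c u) = c *\<^sub>c uea_lift f u"
proof -
  obtain p q where "u = abs_uea p" "v = abs_uea q"
    by (metis Quotient3_abs_rep Quotient3_uea)
  with assms show "uea_lift f 1 = 1" "uea_lift f (u + v) = uea_lift f u + uea_lift f v"
    "uea_lift f (u * v) = uea_lift f u * uea_lift f v" "uea_lift f (c *\<^sub>c u) = c *\<^sub>c uea_lift f u"
    by (simp_all add: one_uea.abs_eq plus_uea.abs_eq times_uea.abs_eq cscale_uea.abs_eq
        uea_lift_abs word_eval_add word_eval_mult cscale_mult_left)
qed

lemma lie_alg_hom_uea_of: "lie_alg_hom (uea_of :: 'g::clie \<Rightarrow> 'g uea)"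
proof -
  have eq: "uea_eq p q" if "p - q \<in> uea_relators" for p q :: "'g list \<Rightarrow>\<^sub>0 complex"
    using that by (simp add: uea_eq_def uea_ideal_relator)
  have eq': "uea_eq q p" if "p - q \<in> uea_relators" for p q :: "'g list \<Rightarrow>\<^sub>0 complex"
    using eq[OF that] equivp_symp[OF equivp_uea_eq] by blast
  have "uea_of (x + y) = uea_of x + uea_of y" for x y :: 'g
    by transfer (rule eq, unfold uea_relators_def, force simp: diff_diff_eq)
  moreover have "uea_of (c *\<^sub>c x) = c *\<^sub>c uea_of x" for c and x :: 'g
    by transfer (rule eq, unfold uea_relators_def, force)
  moreover have "uea_of (bracket x y) = uea_of x * uea_of y - uea_of y * uea_of x" for x y :: 'g
    by transfer (rule eq', unfold uea_relators_def, force)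
  ultimately show ?thesis
    by (simp add: lie_alg_hom_def linear_iff_module_hom module_hom_iff cvec.module_axioms)
qed

section \<open>Tensor products over a noncommutative ring\<close>

text \<open>The tensor product of a right module with action \<open>ract\<close> and a left module with action
  \<open>lact\<close>, as the quotient of the free abelian group on the pairs.\<close>

definition tensor_relators ::
  "('m::ab_group_add \<Rightarrow> 'r \<Rightarrow> 'm) \<Rightarrow> ('r \<Rightarrow> 'n::ab_group_add \<Rightarrow> 'n) \<Rightarrow> ('m \<times> 'n \<Rightarrow>\<^sub>0 int) set" where
  "tensor_relators ract lact =
     {frag_of (a + b, n) - frag_of (a, n) - frag_of (b, n) |a b n. True}
     \<union> {frag_of (a, m + n) - frag_of (a, m) - frag_of (a, n) |a m n. True}
     \<union> {frag_of (ract a r, n) - frag_of (a, lact r n) |a r n. True}"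

definition tensor_eq ::
  "('m::ab_group_add \<Rightarrow> 'r \<Rightarrow> 'm) \<Rightarrow> ('r \<Rightarrow> 'n::ab_group_add \<Rightarrow> 'n) \<Rightarrow> ('m \<times> 'n \<Rightarrow>\<^sub>0 int) rel" where
  "tensor_eq ract lact = {(p, q). p - q \<in> group_closure (tensor_relators ract lact)}"

definition tensor_product ::
  "('m::ab_group_add \<Rightarrow> 'r \<Rightarrow> 'm) \<Rightarrow> ('r \<Rightarrow> 'n::ab_group_add \<Rightarrow> 'n) \<Rightarrow> ('m \<times> 'n \<Rightarrow>\<^sub>0 int) set set" where
  "tensor_product ract lact = UNIV // tensor_eq ract lact"

definition tensor_pure ::
  "('m::ab_group_add \<Rightarrow> 'r \<Rightarrow> 'm) \<Rightarrow> ('r \<Rightarrow> 'n::ab_group_add \<Rightarrow> 'n) \<Rightarrow> 'm \<Rightarrow> 'n \<Rightarrow> ('m \<times> 'n \<Rightarrow>\<^sub>0 int) set" where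
  "tensor_pure ract lact a n = tensor_eq ract lact `` {frag_of (a, n)}"

text \<open>The endomorphism induced by an endomorphism \<open>f\<close> of the right module \<^typ>\<open>'m\<close>.\<close>

definition tensor_map_left ::
  "('m::ab_group_add \<Rightarrow> 'r \<Rightarrow> 'm) \<Rightarrow> ('r \<Rightarrow> 'n::ab_group_add \<Rightarrow> 'n) \<Rightarrow> ('m \<Rightarrow> 'm)
    \<Rightarrow> ('m \<times> 'n \<Rightarrow>\<^sub>0 int) set \<Rightarrow> ('m \<times> 'n \<Rightarrow>\<^sub>0 int) set" where
  "tensor_map_left ract lact f X =
     (\<Union>p\<in>X. tensor_eq ract lact `` {frag_extend (\<lambda>(a, n). frag_of (f a, n)) p})"

lemma equiv_tensor_eq: "equiv UNIV (tensor_eq ract lact)"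
proof (rule equivI)
  show "sym (tensor_eq ract lact)"
  proof (rule symI)
    fix p q assume "(p, q) \<in> tensor_eq ract lact"
    then show "(q, p) \<in> tensor_eq ract lact"
      using group_closure_minus_iff[of "p - q"] by (simp add: tensor_eq_def)
  qed
  show "trans (tensor_eq ract lact)"
  proof (rule transI)
    fix p q r assume "(p, q) \<in> tensor_eq ract lact" "(q, r) \<in> tensor_eq ract lact"
    then show "(p, r) \<in> tensor_eq ract lact"
      using group_closure_add[of "p - q" _ "q - r"] by (simp add: tensor_eq_def)
  qed
qed (simp_all add: refl_on_def tensor_eq_def)

lemma tensor_map_left_class:
  assumes add: "\<And>a b. f (a + b) = f a + f b"
    and comm: "\<And>a r. f (ract a r) = ract (f a) r"
  shows "tensor_map_left ract lact f (tensor_eq ract lact `` {p})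
    = tensor_eq ract lact `` {frag_extend (\<lambda>(a, n). frag_of (f a, n)) p}"
proof -
  let ?F = "frag_extend (\<lambda>(a, n). frag_of (f a, n))"
  have relators: "?F s \<in> tensor_relators ract lact" if "s \<in> tensor_relators ract lact" for s
    using that unfolding tensor_relators_def
    by (elim UnE CollectE exE conjE) (simp_all add: frag_extend_diff add comm, blast+)
  have closure: "?F x \<in> group_closure (tensor_relators ract lact)"
    if "x \<in> group_closure (tensor_relators ract lact)" for x
    using that
  proof (induction rule: group_closure.induct)
    case (base s)
    then have "?F s \<in> insert 0 (tensor_relators ract lact)"
      using relators by auto
    then show ?case by (rule group_closure.base)
  next
    case (diff s t)
    then show ?case
      by (simp add: frag_extend_diff group_closure.diff)
  qed
  have "congruent (tensor_eq ract lact) (\<lambda>p. tensor_eq ract lact `` {?F p})"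
  proof (rule congruentI)
    fix p q assume "(p, q) \<in> tensor_eq ract lact"
    then have "(?F p, ?F q) \<in> tensor_eq ract lact"
      using closure[of "p - q"] by (simp add: tensor_eq_def frag_extend_diff)
    then show "tensor_eq ract lact `` {?F p} = tensor_eq ract lact `` {?F q}"
      by (rule equiv_class_eq[OF equiv_tensor_eq])
  qed
  then show ?thesis
    unfolding tensor_map_left_def by (intro UN_equiv_class[OF equiv_tensor_eq]) simp_all
qed

section \<open>The Schroedinger-Virasoro algebra\<close>

text \<open>The basis vector \<open>YB n\<close> stands for $Y_{n+1/2}$.\<close>

datatype sv_basis = LB int | MB int | YB int

typedef sv = "UNIV :: (sv_basis \<Rightarrow>\<^sub>0 complex) set" ..

setup_lifting type_definition_sv

instantiation sv :: cvec
begin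

lift_definition zero_sv :: sv is 0 .

lift_definition plus_sv :: "sv \<Rightarrow> sv \<Rightarrow> sv" is "(+)" .

lift_definition uminus_sv :: "sv \<Rightarrow> sv" is uminus .

lift_definition minus_sv :: "sv \<Rightarrow> sv \<Rightarrow> sv" is "(-)" .

lift_definition cscale_sv :: "complex \<Rightarrow> sv \<Rightarrow> sv" is "\<lambda>c. Poly_Mapping.map ((*) c)" .

lemma sv_eqI:
  assumes "\<And>b. poly_mapping.lookup (Rep_sv x) b = poly_mapping.lookup (Rep_sv y) b"
  shows "x = y"
  using assms by (metis Rep_sv_inject poly_mapping_eqI)

lemma lookup_cscale_sv:
  "poly_mapping.lookup (Rep_sv (c *\<^sub>c x)) b = c * poly_mapping.lookup (Rep_sv x) b"
  by (simp add: cscale_sv.rep_eq Poly_Mapping.map.rep_eq when_def)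

instance
  by standard
    (rule sv_eqI, simp add: zero_sv.rep_eq plus_sv.rep_eq uminus_sv.rep_eq minus_sv.rep_eq
      lookup_add lookup_minus lookup_cscale_sv distrib_left distrib_right)+

end

lift_definition L :: "int \<Rightarrow> sv" is "\<lambda>n. Poly_Mapping.single (LB n) 1" .

lift_definition M :: "int \<Rightarrow> sv" is "\<lambda>n. Poly_Mapping.single (MB n) 1" .

lift_definition Y :: "int \<Rightarrow> sv" is "\<lambda>n. Poly_Mapping.single (YB n) 1" .

fun sv_basis_bracket :: "sv_basis \<Rightarrow> sv_basis \<Rightarrow> sv" where
  "sv_basis_bracket (LB m) (LB n) = of_int (n - m) *\<^sub>c L (m + n)"
| "sv_basis_bracket (LB m) (MB n) = of_int n *\<^sub>c M (m + n)"
| "sv_basis_bracket (MB n) (LB m) = - (of_int n *\<^sub>c M (m + n))"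
| "sv_basis_bracket (LB m) (YB n) = (of_int n + (1 - of_int m) / 2) *\<^sub>c Y (m + n)"
| "sv_basis_bracket (YB n) (LB m) = - ((of_int n + (1 - of_int m) / 2) *\<^sub>c Y (m + n))"
| "sv_basis_bracket (YB m) (YB n) = of_int (n - m) *\<^sub>c M (m + n + 1)"
| "sv_basis_bracket (MB m) (MB n) = 0"
| "sv_basis_bracket (MB m) (YB n) = 0"
| "sv_basis_bracket (YB m) (MB n) = 0"

lemma sv_induct [case_names L M Y add scale zero]:
  assumes "\<And>n. P (L n)" "\<And>n. P (M n)" "\<And>n. P (Y n)"
    "\<And>x y. P x \<Longrightarrow> P y \<Longrightarrow> P (x + y)" "\<And>c x. P x \<Longrightarrow> P (c *\<^sub>c x)" "P 0"
  shows "P x"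
proof -
  have "P (Abs_sv p)" for p
  proof (induction p rule: poly_mapping_single_induct)
    case zero
    then show ?case using assms(6) by (simp add: zero_sv_def)
  next
    case (single_add k c p)
    have "Abs_sv (Poly_Mapping.single k c) = c *\<^sub>c Abs_sv (Poly_Mapping.single k 1)"
      by (simp add: cscale_sv.abs_eq eq_onp_def)
    moreover have "P (Abs_sv (Poly_Mapping.single k 1))"
      using assms(1-3) by (cases k) (simp_all add: L_def M_def Y_def)
    ultimately have "P (Abs_sv (Poly_Mapping.single k c))"
      using assms(5) by simp
    with single_add assms(4) show ?case
      by (metis plus_sv.abs_eq eq_onp_same_args UNIV_I)
  qed
  then show ?thesis by (metis Rep_sv_inverse)
qed

instantiation sv :: clie
begin

definition bracket_sv :: "sv \<Rightarrow> sv \<Rightarrow> sv" where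
  "bracket_sv x y = lin_ext (\<lambda>a. lin_ext (sv_basis_bracket a) (Rep_sv y)) (Rep_sv x)"

lemma bracket_sv_bilinear:
  fixes x y z :: sv
  shows "bracket (x + y) z = bracket x z + bracket y z"
    and "bracket x (y + z) = bracket x y + bracket x z"
    and "bracket (c *\<^sub>c x) y = c *\<^sub>c bracket x y"
    and "bracket x (c *\<^sub>c y) = c *\<^sub>c bracket x y"
  by (simp_all add: bracket_sv_def plus_sv.rep_eq cscale_sv.rep_eq lin_ext_add lin_ext_map
      lin_ext_fun_add lin_ext_fun_scale)

lemma bracket_sv_zero: "bracket (0::sv) x = 0" "bracket x (0::sv) = 0"
  using bracket_sv_bilinear(1)[of 0 0 x] bracket_sv_bilinear(2)[of x 0 0] by simp_all

lemma bracket_sv_uminus: "bracket (- x) y = - bracket x (y::sv)" "bracket x (- y) = - bracket x (y::sv)"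
  using bracket_sv_bilinear(1)[of x "- x" y] bracket_sv_bilinear(2)[of x y "- y"]
  by (simp_all add: bracket_sv_zero eq_neg_iff_add_eq_0 add.commute)

lemma bracket_sv_basis:
  "bracket (L m) (L n) = of_int (n - m) *\<^sub>c L (m + n)"
  "bracket (L m) (M n) = of_int n *\<^sub>c M (m + n)"
  "bracket (M n) (L m) = - (of_int n *\<^sub>c M (m + n))"
  "bracket (L m) (Y n) = (of_int n + (1 - of_int m) / 2) *\<^sub>c Y (m + n)"
  "bracket (Y n) (L m) = - ((of_int n + (1 - of_int m) / 2) *\<^sub>c Y (m + n))"
  "bracket (Y m) (Y n) = of_int (n - m) *\<^sub>c M (m + n + 1)"
  "bracket (M m) (M n) = 0"
  "bracket (M m) (Y n) = 0"
  "bracket (Y m) (M n) = 0"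
  by (simp_all add: bracket_sv_def L.rep_eq M.rep_eq Y.rep_eq cscale_one)

lemmas sv_coordinates =
  zero_sv.rep_eq plus_sv.rep_eq uminus_sv.rep_eq minus_sv.rep_eq L.rep_eq M.rep_eq Y.rep_eq
  lookup_add lookup_minus lookup_single

lemma bracket_sv_antisym: "bracket x y = - bracket y (x::sv)"
proof (induction x rule: sv_induct)
  case (L n)
  show ?case
    by (induction y rule: sv_induct)
      (simp_all add: bracket_sv_basis bracket_sv_bilinear bracket_sv_zero,
        (rule sv_eqI, simp add: sv_coordinates lookup_cscale_sv when_def algebra_simps)+)
next
  case (M n)
  show ?case
    by (induction y rule: sv_induct)
      (simp_all add: bracket_sv_basis bracket_sv_bilinear bracket_sv_zero)
next
  case (Y n)
  show ?case
    by (induction y rule: sv_induct)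
      (simp_all add: bracket_sv_basis bracket_sv_bilinear bracket_sv_zero,
        (rule sv_eqI, simp add: sv_coordinates lookup_cscale_sv when_def algebra_simps)+)
qed (simp_all add: bracket_sv_bilinear bracket_sv_zero)

abbreviation (input) jacobiator :: "sv \<Rightarrow> sv \<Rightarrow> sv \<Rightarrow> sv" where
  "jacobiator x y z \<equiv>
     bracket x (bracket y z) + bracket y (bracket z x) + bracket z (bracket x y)"

lemma jacobiator_LLL: "jacobiator (L m) (L n) (L k) = 0"
  and jacobiator_LLM: "jacobiator (L m) (L n) (M k) = 0"
  and jacobiator_LLY: "jacobiator (L m) (L n) (Y k) = 0"
  and jacobiator_LYY: "jacobiator (L m) (Y n) (Y k) = 0"
  by (rule sv_eqI, simp add: bracket_sv_basis bracket_sv_bilinear bracket_sv_zero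
      bracket_sv_uminus sv_coordinates lookup_cscale_sv when_def, simp add: field_simps)+

lemma jacobiator_trivial:
  "jacobiator (L m) (M n) (M k) = 0" "jacobiator (L m) (M n) (Y k) = 0"
  "jacobiator (M m) (M n) (M k) = 0" "jacobiator (M m) (M n) (Y k) = 0"
  "jacobiator (M m) (Y n) (Y k) = 0" "jacobiator (Y m) (Y n) (Y k) = 0"
  by (simp_all add: bracket_sv_basis bracket_sv_bilinear bracket_sv_zero bracket_sv_uminus)

lemma jacobiator_swap: "jacobiator y x z = - jacobiator x y (z::sv)"
  using bracket_sv_antisym[of x z] bracket_sv_antisym[of y z] bracket_sv_antisym[of x y]
  by (simp add: bracket_sv_uminus)

lemma jacobiator_perm:
  assumes "jacobiator x y (z::sv) = 0"
  shows "jacobiator y z x = 0" and "jacobiator z x y = 0" and "jacobiator y x z = 0"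
    and "jacobiator x z y = 0" and "jacobiator z y x = 0"
  using assms jacobiator_swap[of y x z] jacobiator_swap[of z y x] jacobiator_swap[of x z y]
  by (simp_all add: ac_simps)

lemma jacobiator_basis:
  assumes "x \<in> range L \<union> range M \<union> range Y" "y \<in> range L \<union> range M \<union> range Y"
    "z \<in> range L \<union> range M \<union> range Y"
  shows "jacobiator x y z = 0"
proof -
  note base = jacobiator_LLL jacobiator_LLM jacobiator_LLY jacobiator_LYY jacobiator_trivial
  note all = base base[THEN jacobiator_perm(1)] base[THEN jacobiator_perm(2)]
    base[THEN jacobiator_perm(3)] base[THEN jacobiator_perm(4)] base[THEN jacobiator_perm(5)]
  show ?thesis
    using assms by (elim UnE rangeE; hypsubst) (rule all)+
qed

lemma jacobiator_linear:
  "jacobiator (x + x') y z = jacobiator x y z + jacobiator x' y (z::sv)"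
  "jacobiator x (y + y') z = jacobiator x y z + jacobiator x y' (z::sv)"
  "jacobiator x y (z + z') = jacobiator x y z + jacobiator x y (z'::sv)"
  "jacobiator (c *\<^sub>c x) y z = c *\<^sub>c jacobiator x y (z::sv)"
  "jacobiator x (c *\<^sub>c y) z = c *\<^sub>c jacobiator x y (z::sv)"
  "jacobiator x y (c *\<^sub>c z) = c *\<^sub>c jacobiator x y (z::sv)"
  "jacobiator 0 y z = 0" "jacobiator x 0 z = 0" "jacobiator x y 0 = 0"
  by (simp_all add: bracket_sv_bilinear bracket_sv_zero cscale_add_right ac_simps)

lemma jacobiator_zero: "jacobiator x y (z::sv) = 0"
proof -
  let ?B = "range L \<union> range M \<union> range Y"
  have 1: "jacobiator a b z = 0" if "a \<in> ?B" "b \<in> ?B" for a b z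
    by (induction z rule: sv_induct)
      (use that in \<open>simp_all only: jacobiator_basis jacobiator_linear UnI1 UnI2 rangeI
        add_0 cvec.scale_zero_right\<close>)
  have 2: "jacobiator a y z = 0" if "a \<in> ?B" for a y z
    by (induction y rule: sv_induct)
      (use that in \<open>simp_all only: 1 jacobiator_linear UnI1 UnI2 rangeI
        add_0 cvec.scale_zero_right\<close>)
  show ?thesis
    by (induction x rule: sv_induct)
      (simp_all only: 2 jacobiator_linear UnI1 UnI2 rangeI add_0 cvec.scale_zero_right)
qed

instance
proof
  fix x y z :: sv
  have "bracket x x + bracket x x = 0"
    using bracket_sv_antisym[of x x] by (simp add: eq_neg_iff_add_eq_0)
  then have "(1 + 1) *\<^sub>c bracket x x = 0"
    by (simp only: cscale_add_left cscale_one)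
  then show "bracket x x = 0"
    by simp
qed (rule bracket_sv_bilinear jacobiator_zero)+

end

definition sv_plus_space :: "sv set" where
  "sv_plus_space = cvec.span ({L n |n. n \<ge> 1} \<union> {M n |n. n \<ge> 1} \<union> {Y m |m. m \<ge> 0})"

lemma sv_plus_space_bracket:
  assumes "x \<in> sv_plus_space" "y \<in> sv_plus_space"
  shows "bracket x y \<in> sv_plus_space"
proof -
  let ?G = "{L n |n. n \<ge> 1} \<union> {M n |n. n \<ge> 1} \<union> {Y m |m. m \<ge> 0}"
  have LMY: "n \<ge> 1 \<Longrightarrow> L n \<in> cvec.span ?G" "n \<ge> 1 \<Longrightarrow> M n \<in> cvec.span ?G" "n \<ge> 0 \<Longrightarrow> Y n \<in> cvec.span ?G" for n
    by (auto intro: cvec.span_base)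
  have 1: "bracket a b \<in> cvec.span ?G" if "a \<in> ?G" "b \<in> ?G" for a b
    using that
    by (auto simp: bracket_sv_basis intro!: LMY cvec.span_scale cvec.span_neg cvec.span_zero)
  have 2: "bracket a y \<in> cvec.span ?G" if "a \<in> ?G" "y \<in> cvec.span ?G" for a y
    using that(2)
  proof (induction rule: cvec.span_induct_alt)
    case (step c b y)
    then show ?case
      by (auto simp only: bracket_add_right bracket_scale_right
          intro!: cvec.span_add cvec.span_scale 1[OF that(1)])
  qed (simp add: bracket_sv_zero cvec.span_zero)
  from assms(1) show ?thesis
    unfolding sv_plus_space_def
  proof (induction rule: cvec.span_induct_alt)
    case (step c b x)
    then show ?case
      using assms(2) unfolding sv_plus_space_def
      by (auto simp only: bracket_add_left bracket_scale_left
          intro!: cvec.span_add cvec.span_scale 2)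
  qed (simp add: bracket_sv_zero cvec.span_zero)
qed

typedef sv_plus = sv_plus_space
  unfolding sv_plus_space_def using cvec.span_zero by blast

setup_lifting type_definition_sv_plus

instantiation sv_plus :: clie
begin

lift_definition zero_sv_plus :: sv_plus is 0
  by (simp add: sv_plus_space_def cvec.span_zero)

lift_definition plus_sv_plus :: "sv_plus \<Rightarrow> sv_plus \<Rightarrow> sv_plus" is "(+)"
  by (simp add: sv_plus_space_def cvec.span_add)

lift_definition uminus_sv_plus :: "sv_plus \<Rightarrow> sv_plus" is uminus
  by (simp add: sv_plus_space_def cvec.span_neg)

lift_definition minus_sv_plus :: "sv_plus \<Rightarrow> sv_plus \<Rightarrow> sv_plus" is "(-)"
  by (simp add: sv_plus_space_def cvec.span_diff)

lift_definition cscale_sv_plus :: "complex \<Rightarrow> sv_plus \<Rightarrow> sv_plus" is "(*\<^sub>c)"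
  by (simp add: sv_plus_space_def cvec.span_scale)

lift_definition bracket_sv_plus :: "sv_plus \<Rightarrow> sv_plus \<Rightarrow> sv_plus" is bracket
  by (rule sv_plus_space_bracket)

instance
  by standard
    (transfer; simp add: cscale_add_right cscale_add_left cscale_cscale cscale_one
      bracket_add_left bracket_add_right bracket_scale_left bracket_scale_right bracket_self
      jacobi)+

end

text \<open>The basis vectors as elements of the subalgebra; they are only meaningful for
  \<open>n \<ge> 1\<close> (\<open>Lp\<close>, \<open>Mp\<close>) and \<open>n \<ge> 0\<close> (\<open>Yp\<close>).\<close>

definition Lp :: "int \<Rightarrow> sv_plus" where "Lp n = Abs_sv_plus (L n)"

definition Mp :: "int \<Rightarrow> sv_plus" where "Mp n = Abs_sv_plus (M n)"

definition Yp :: "int \<Rightarrow> sv_plus" where "Yp n = Abs_sv_plus (Y n)"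

lemma Rep_sv_plus_basis:
  "n \<ge> 1 \<Longrightarrow> Rep_sv_plus (Lp n) = L n"
  "n \<ge> 1 \<Longrightarrow> Rep_sv_plus (Mp n) = M n"
  "n \<ge> 0 \<Longrightarrow> Rep_sv_plus (Yp n) = Y n"
  unfolding Lp_def Mp_def Yp_def
  by (auto simp: sv_plus_space_def intro!: Abs_sv_plus_inverse cvec.span_base)

text \<open>The inclusion of \<^typ>\<open>sv_plus\<close> into the enveloping algebra of \<^typ>\<open>sv\<close> and the induced
  homomorphism of enveloping algebras.\<close>

definition sv_plus_uea :: "sv_plus \<Rightarrow> sv uea" where
  "sv_plus_uea x = uea_of (Rep_sv_plus x)"

definition uea_incl :: "sv_plus uea \<Rightarrow> sv uea" where
  "uea_incl = uea_lift sv_plus_uea"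

lemma lie_alg_hom_sv_plus_uea: "lie_alg_hom sv_plus_uea"
  using lie_alg_hom_uea_of[where 'g = sv]
  by (simp add: lie_alg_hom_def linear_iff_module_hom module_hom_iff cvec.module_axioms
      sv_plus_uea_def plus_sv_plus.rep_eq cscale_sv_plus.rep_eq bracket_sv_plus.rep_eq)

section \<open>The universal Whittaker module\<close>

definition right_act :: "sv uea \<Rightarrow> sv_plus uea \<Rightarrow> sv uea" where
  "right_act a h = a * uea_incl h"

definition C_act :: "(sv_plus \<Rightarrow> complex) \<Rightarrow> sv_plus uea \<Rightarrow> complex \<Rightarrow> complex" where
  "C_act \<psi> h \<alpha> = uea_lift \<psi> h * \<alpha>"

definition W :: "(sv_plus \<Rightarrow> complex) \<Rightarrow> (sv uea \<times> complex \<Rightarrow>\<^sub>0 int) set set" where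
  "W \<psi> = tensor_product right_act (C_act \<psi>)"

definition W_act :: "(sv_plus \<Rightarrow> complex) \<Rightarrow> sv uea
    \<Rightarrow> (sv uea \<times> complex \<Rightarrow>\<^sub>0 int) set \<Rightarrow> (sv uea \<times> complex \<Rightarrow>\<^sub>0 int) set" where
  "W_act \<psi> u = tensor_map_left right_act (C_act \<psi>) ((*) u)"

text \<open>The vector space structure: scalars act through the left factor.\<close>

definition W_scale :: "(sv_plus \<Rightarrow> complex) \<Rightarrow> complex
    \<Rightarrow> (sv uea \<times> complex \<Rightarrow>\<^sub>0 int) set \<Rightarrow> (sv uea \<times> complex \<Rightarrow>\<^sub>0 int) set" where
  "W_scale \<psi> c = tensor_map_left right_act (C_act \<psi>) ((*\<^sub>c) c)"

definition W_gen :: "(sv_plus \<Rightarrow> complex) \<Rightarrow> (sv uea \<times> complex \<Rightarrow>\<^sub>0 int) set" where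
  "W_gen \<psi> = tensor_pure right_act (C_act \<psi>) 1 1"

lemma W_act_class:
  "W_act \<psi> u (tensor_eq right_act (C_act \<psi>) `` {p})
    = tensor_eq right_act (C_act \<psi>) `` {frag_extend (\<lambda>(a, n). frag_of (u * a, n)) p}"
  unfolding W_act_def
  by (rule tensor_map_left_class) (simp_all add: right_act_def distrib_left mult.assoc)

lemma W_scale_class:
  "W_scale \<psi> c (tensor_eq right_act (C_act \<psi>) `` {p})
    = tensor_eq right_act (C_act \<psi>) `` {frag_extend (\<lambda>(a, n). frag_of (c *\<^sub>c a, n)) p}"
  unfolding W_scale_def
  by (rule tensor_map_left_class) (simp_all add: right_act_def cscale_add_right cscale_mult_left)

lemma W_act_pure:
  "W_act \<psi> u (tensor_pure right_act (C_act \<psi>) a \<alpha>) = tensor_pure right_act (C_act \<psi>) (u * a) \<alpha>"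
  by (simp add: tensor_pure_def W_act_class)

definition whittaker_vector ::
  "(sv_plus \<Rightarrow> complex) \<Rightarrow> (sv uea \<times> complex \<Rightarrow>\<^sub>0 int) set \<Rightarrow> bool" where
  "whittaker_vector \<psi> v \<longleftrightarrow>
     v \<in> W \<psi> \<and> (\<forall>x. W_act \<psi> (sv_plus_uea x) v = W_scale \<psi> (\<psi> x) v)"

abbreviation L\<^sub>U :: "int \<Rightarrow> sv uea" where "L\<^sub>U n \<equiv> uea_of (L n)"

abbreviation M\<^sub>U :: "int \<Rightarrow> sv uea" where "M\<^sub>U n \<equiv> uea_of (M n)"

abbreviation Y\<^sub>U :: "int \<Rightarrow> sv uea" where "Y\<^sub>U n \<equiv> uea_of (Y n)"

end

theory Submission
  imports Defs
begin

text \<open>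
  In \<open>W\<^sub>\<psi>\<close> the generator \<open>w = 1 \<otimes> 1\<close> is annihilated by the left ideal \<open>I\<close> of
  \<open>U(\<ss>\<vv>)\<close> generated by the elements \<open>x - \<psi>(x)\<close> with \<open>x \<in> \<ss>\<vv>\<^sup>+\<close>, so \<open>u w\<close> is a Whittaker
  vector as soon as \<open>(x - \<psi>(x)) u \<in> I\<close> for all these \<open>x\<close>.  Since \<open>I\<close> is generated by the
  \<open>x - \<psi>(x)\<close>, this condition amounts to \<open>I u \<subseteq> I\<close>; it therefore defines a subalgebra, the
  idealizer of \<open>I\<close> (\<open>idealizer_subalgebra\<close>).  So only the algebra generators \<open>u = z\<close> and
  \<open>u = M\<^sub>0\<close> matter, and because \<open>u (x - \<psi>(x)) \<in> I\<close> in any case, what has to be shown is that the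
  commutators \<open>[x, u]\<close> lie in \<open>I\<close> (\<open>whittaker_vector_subalgebra\<close>).  This is linear in \<open>x\<close>, so \<open>x\<close>
  may be taken among the basis vectors of \<open>\<ss>\<vv>\<^sup>+\<close>.

  For \<open>M\<^sub>0\<close> all commutators vanish.  For \<open>z\<close> they are computed with the derivation rule.  Modulo
  \<open>I\<close> every \<open>M\<^sub>n\<close> with \<open>n \<ge> 1\<close> standing on the right dies, as do \<open>L\<^sub>n\<close> for \<open>n \<ge> 3\<close> and
  \<open>Y\<^bsub>n+1/2\<^esub>\<close> for \<open>n \<ge> 1\<close>; so only \<open>L\<^sub>1\<close>, \<open>L\<^sub>2\<close> and \<open>Y\<^bsub>1/2\<^esub>\<close> leave something to check.  The
  element \<open>z\<close> is built so that these three cancel: commuting with \<open>L\<^sub>0 M\<^sub>0\<^sup>2\<close> produces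
  \<open>- \<eta>\<^sub>1 M\<^sub>0\<^sup>2\<close>, \<open>- 2 \<eta>\<^sub>2 M\<^sub>0\<^sup>2\<close> and \<open>- \<eta>\<^sub>3/2 M\<^sub>0\<^sup>2\<close>, which the terms in \<open>M\<^bsub>-1\<^esub> M\<^sub>0\<close>,
  \<open>M\<^bsub>-2\<^esub> M\<^sub>0\<close> and \<open>Y\<^bsub>-1/2\<^esub> M\<^sub>0\<close> compensate, while the terms in \<open>M\<^bsub>-1\<^esub>\<^sup>2\<close> and \<open>M\<^bsub>-1\<^esub>\<close> correct
  the contribution of \<open>L\<^sub>1\<close> that the latter two produce in turn.
  If \<open>\<eta>\<^sub>2 = \<eta>\<^sub>3 = 0\<close>, this expression has a factor \<open>M\<^sub>0\<close>, and the quotient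
  \<open>L\<^sub>0 M\<^sub>0 - \<eta>\<^sub>1 M\<^bsub>-1\<^esub>\<close> already works by the same cancellation; if \<open>\<psi> = 0\<close>, there is
  nothing to compensate and \<open>L\<^sub>0\<close> itself works.
\<close>

section \<open>Left ideals and their idealizers\<close>

inductive_set left_ideal_generated :: "'a::ring_1 set \<Rightarrow> 'a set" for S where
  zero: "0 \<in> left_ideal_generated S"
| add: "a \<in> left_ideal_generated S \<Longrightarrow> b \<in> left_ideal_generated S \<Longrightarrow> a + b \<in> left_ideal_generated S"
| mult_gen: "s \<in> S \<Longrightarrow> a * s \<in> left_ideal_generated S"

lemma left_ideal_generated_mult:
  assumes "b \<in> left_ideal_generated S"
  shows "a * b \<in> left_ideal_generated S"
  using assms
  by induction (simp_all add: distrib_left left_ideal_generated.intros flip: mult.assoc)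

lemma left_ideal_generated_uminus:
  assumes "b \<in> left_ideal_generated S"
  shows "- b \<in> left_ideal_generated S"
  using left_ideal_generated_mult[OF assms, of "- 1"] by simp

lemma left_ideal_generated_diff:
  "a \<in> left_ideal_generated S \<Longrightarrow> b \<in> left_ideal_generated S \<Longrightarrow> a - b \<in> left_ideal_generated S"
  using left_ideal_generated.add[OF _ left_ideal_generated_uminus, of a S b] by simp

lemma left_ideal_generated_cscale:
  fixes b :: "'a::calg"
  assumes "b \<in> left_ideal_generated S"
  shows "c *\<^sub>c b \<in> left_ideal_generated S"
  using left_ideal_generated_mult[OF assms, of "c *\<^sub>c 1"] by (simp add: cscale_mult_left)

lemmas left_ideal_closure =
  left_ideal_generated.zero left_ideal_generated.add left_ideal_generated_mult
  left_ideal_generated_uminus left_ideal_generated_diff left_ideal_generated_cscale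

text \<open>The product case is where the generators must be replaced by the whole ideal: from
  \<open>I u \<subseteq> I\<close> and \<open>I v \<subseteq> I\<close> one gets \<open>I u v \<subseteq> I v \<subseteq> I\<close>, whereas for \<open>s \<in> S\<close> the
  element \<open>s u\<close> is no longer a generator to which the hypothesis on \<open>v\<close> could be applied.\<close>

lemma idealizer_subalgebra:
  fixes S Z :: "'a::calg set"
  assumes gen: "\<And>s z. s \<in> S \<Longrightarrow> z \<in> Z \<Longrightarrow> s * z \<in> left_ideal_generated S"
    and u: "u \<in> subalgebra_generated Z" and a: "a \<in> left_ideal_generated S"
  shows "a * u \<in> left_ideal_generated S"
  using u a
proof (induction arbitrary: a)
  case (gen z)
  from gen(2) show ?case
  proof induction
    case (mult_gen s b)
    then show ?case
      using left_ideal_generated_mult[OF assms(1)[OF mult_gen gen(1)], of b] by (simp add: mult.assoc)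
  qed (simp_all add: distrib_right left_ideal_closure)
next
  case (mult u v)
  then show ?case by (simp flip: mult.assoc)
qed (simp_all add: distrib_left cscale_mult_right left_ideal_closure)

section \<open>Commutators in the enveloping algebra\<close>

definition commutator :: "'a::ring_1 \<Rightarrow> 'a \<Rightarrow> 'a" where
  "commutator a b = a * b - b * a"

lemma commutator_linear:
  fixes a b c :: "'a::calg"
  shows "commutator a (b + c) = commutator a b + commutator a c"
    and "commutator a (b - c) = commutator a b - commutator a c"
    and "commutator a (k *\<^sub>c b) = k *\<^sub>c commutator a b"
    and "commutator (a + b) c = commutator a c + commutator b c"
    and "commutator (k *\<^sub>c a) b = k *\<^sub>c commutator a b"
  by (simp_all add: commutator_def algebra_simps cscale_mult_left cscale_mult_right
      cvec.scale_right_diff_distrib)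

lemma commutator_mult: "commutator a (b * c) = commutator a b * c + b * commutator a c"
  by (simp add: commutator_def algebra_simps)

lemma uea_of_linear:
  "uea_of (x + y) = uea_of x + uea_of y" "uea_of (c *\<^sub>c x) = c *\<^sub>c uea_of x"
  "uea_of (- x) = - uea_of x" "uea_of (x - y) = uea_of x - uea_of y" "uea_of 0 = (0 :: 'g uea)" for x y :: "'g::clie"
proof -
  interpret uea_of: Vector_Spaces.linear cscale cscale "uea_of :: 'g \<Rightarrow> 'g uea"
    using lie_alg_hom_uea_of[where 'g = 'g] by (simp add: lie_alg_hom_def)
  show "uea_of (x + y) = uea_of x + uea_of y" "uea_of (c *\<^sub>c x) = c *\<^sub>c uea_of x"
    "uea_of (- x) = - uea_of x" "uea_of (x - y) = uea_of x - uea_of y" "uea_of 0 = (0 :: 'g uea)"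
    by (simp_all add: uea_of.add uea_of.scale uea_of.neg uea_of.diff)
qed

lemma commutator_uea_of:
  "commutator (uea_of x) (uea_of y) = uea_of (bracket x y)" for x y :: "'g::clie"
  using lie_alg_hom_uea_of[where 'g = 'g] by (simp add: lie_alg_hom_def commutator_def)

lemmas sv_commutator = commutator_uea_of bracket_sv_basis uea_of_linear

lemma M_U_commute: "M\<^sub>U m * M\<^sub>U n = M\<^sub>U n * M\<^sub>U m"
  using commutator_uea_of[of "M m" "M n"]
  by (simp add: commutator_def bracket_sv_basis uea_of_linear)

lemma M0_central: "uea_of x * M\<^sub>U 0 = M\<^sub>U 0 * uea_of x"
proof (induction x rule: sv_induct)
  case (L n)
  show ?case using commutator_uea_of[of "L n" "M 0"]
    by (simp add: commutator_def bracket_sv_basis uea_of_linear)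
next
  case (Y n)
  show ?case using commutator_uea_of[of "Y n" "M 0"]
    by (simp add: commutator_def bracket_sv_basis uea_of_linear)
qed (simp_all add: M_U_commute uea_of_linear algebra_simps cscale_mult_left cscale_mult_right)

section \<open>The annihilator of the Whittaker generator\<close>

definition whittaker_ideal :: "(sv_plus \<Rightarrow> complex) \<Rightarrow> sv uea set" where
  "whittaker_ideal \<psi> = left_ideal_generated (range (\<lambda>x. sv_plus_uea x - \<psi> x *\<^sub>c 1))"

lemmas whittaker_ideal_closure =
  left_ideal_closure[where S = "range (\<lambda>x. sv_plus_uea x - \<psi> x *\<^sub>c 1)", folded whittaker_ideal_def]
  for \<psi> :: "sv_plus \<Rightarrow> complex"

lemma whittaker_ideal_gen: "a * sv_plus_uea x - \<psi> x *\<^sub>c a \<in> whittaker_ideal \<psi>"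
  using left_ideal_generated.mult_gen[OF rangeI, of a "\<lambda>x. sv_plus_uea x - \<psi> x *\<^sub>c 1" x]
  by (simp add: whittaker_ideal_def right_diff_distrib cscale_mult_right)

lemma whittaker_ideal_basis:
  "n \<ge> 1 \<Longrightarrow> a * L\<^sub>U n - \<psi> (Lp n) *\<^sub>c a \<in> whittaker_ideal \<psi>"
  "n \<ge> 1 \<Longrightarrow> a * M\<^sub>U n - \<psi> (Mp n) *\<^sub>c a \<in> whittaker_ideal \<psi>"
  "n \<ge> 0 \<Longrightarrow> a * Y\<^sub>U n - \<psi> (Yp n) *\<^sub>c a \<in> whittaker_ideal \<psi>"
  using whittaker_ideal_gen[of a "Lp n" \<psi>] whittaker_ideal_gen[of a "Mp n" \<psi>]
    whittaker_ideal_gen[of a "Yp n" \<psi>]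
  by (simp_all add: sv_plus_uea_def Rep_sv_plus_basis)

text \<open>Elements of the tensor product are cosets without a sum operation; this congruence stands in
  for the additivity of \<open>a \<mapsto> a \<otimes> n\<close>.\<close>

lemma tensor_pure_add_cong:
  assumes "tensor_pure ract lact a n = tensor_pure ract lact a' n"
    and "tensor_pure ract lact b n = tensor_pure ract lact b' n"
  shows "tensor_pure ract lact (a + b) n = tensor_pure ract lact (a' + b') n"
proof -
  let ?G = "group_closure (tensor_relators ract lact)"
  let ?f = "\<lambda>a. frag_of (a, n)"
  have eq: "tensor_pure ract lact x n = tensor_pure ract lact y n \<longleftrightarrow> ?f x - ?f y \<in> ?G" for x y
    unfolding tensor_pure_def
    by (subst eq_equiv_class_iff[OF equiv_tensor_eq]) (simp_all add: tensor_eq_def)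
  have rel: "?f (x + y) - ?f x - ?f y \<in> ?G" for x y
    unfolding tensor_relators_def by (intro group_closure.base insertI2 UnI1) blast
  have "(?f (a + b) - ?f a - ?f b) - (?f (a' + b') - ?f a' - ?f b')
      + ((?f a - ?f a') + (?f b - ?f b')) \<in> ?G"
    using assms by (intro group_closure_add group_closure.diff[OF rel rel]) (simp_all add: eq)
  then show ?thesis
    by (simp add: eq algebra_simps)
qed

lemma tensor_pure_act:
  "tensor_pure ract lact (ract a r) n = tensor_pure ract lact a (lact r n)"
proof -
  have "frag_of (ract a r, n) - frag_of (a, lact r n) \<in> group_closure (tensor_relators ract lact)"
    unfolding tensor_relators_def by (intro group_closure.base insertI2 UnI2) blast
  then show ?thesis
    unfolding tensor_pure_def
    by (intro equiv_class_eq[OF equiv_tensor_eq]) (simp add: tensor_eq_def)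
qed

lemma W_pure_scale:
  assumes "lie_hom \<psi>"
  shows "tensor_pure right_act (C_act \<psi>) (c *\<^sub>c a) 1 = tensor_pure right_act (C_act \<psi>) a c"
  using tensor_pure_act[of right_act "C_act \<psi>" a "c *\<^sub>c 1" 1]
    uea_lift_hom(1,4)[OF lie_alg_hom_character[OF assms]] uea_lift_hom(1,4)[OF lie_alg_hom_sv_plus_uea]
  by (simp add: right_act_def C_act_def uea_incl_def cscale_mult_right cscale_complex_def)

text \<open>The balancing relation of the tensor product moves \<open>x \<in> \<ss>\<vv>\<^sup>+\<close> from the left factor to
  \<open>\<complex>\<^sub>\<psi>\<close>, where it becomes the scalar \<open>\<psi>(x)\<close>, which moves back to the left.\<close>

lemma whittaker_ideal_annihilates:
  assumes hom: "lie_hom \<psi>" and "a \<in> whittaker_ideal \<psi>"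
  shows "tensor_pure right_act (C_act \<psi>) a 1 = tensor_pure right_act (C_act \<psi>) 0 1"
  using assms(2) unfolding whittaker_ideal_def
proof (induction rule: left_ideal_generated.induct)
  case (add a b)
  then show ?case using tensor_pure_add_cong[OF add.IH] by simp
next
  case (mult_gen s a)
  then obtain x where s: "s = sv_plus_uea x - \<psi> x *\<^sub>c 1" by blast
  let ?p = "\<lambda>a. tensor_pure right_act (C_act \<psi>) a 1"
  have "?p (a * sv_plus_uea x) = tensor_pure right_act (C_act \<psi>) a (\<psi> x)"
    using tensor_pure_act[of right_act "C_act \<psi>" a "uea_of x" 1]
    by (simp add: right_act_def C_act_def uea_incl_def uea_lift_of lie_alg_hom_sv_plus_uea
        lie_alg_hom_character[OF hom])
  also have "\<dots> = ?p (\<psi> x *\<^sub>c a)"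
    by (rule W_pure_scale[OF hom, symmetric])
  finally have "?p (a * sv_plus_uea x + - (\<psi> x *\<^sub>c a)) = ?p (\<psi> x *\<^sub>c a + - (\<psi> x *\<^sub>c a))"
    by (rule tensor_pure_add_cong) simp
  then show ?case
    by (simp add: s right_diff_distrib cscale_mult_right)
qed simp

section \<open>Whittaker vectors from commutators\<close>

lemma W_scale_pure:
  "W_scale \<psi> c (tensor_pure right_act (C_act \<psi>) a \<alpha>) = tensor_pure right_act (C_act \<psi>) (c *\<^sub>c a) \<alpha>"
  by (simp add: tensor_pure_def W_scale_class)

lemma whittaker_vectorI:
  assumes hom: "lie_hom \<psi>"
    and u: "\<And>x. (sv_plus_uea x - \<psi> x *\<^sub>c 1) * u \<in> whittaker_ideal \<psi>"
  shows "whittaker_vector \<psi> (W_act \<psi> u (W_gen \<psi>))"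
proof -
  let ?p = "\<lambda>a. tensor_pure right_act (C_act \<psi>) a 1"
  have "?p (sv_plus_uea x * u) = ?p (\<psi> x *\<^sub>c u)" for x
  proof -
    have "?p ((sv_plus_uea x - \<psi> x *\<^sub>c 1) * u + \<psi> x *\<^sub>c u) = ?p (0 + \<psi> x *\<^sub>c u)"
      by (rule tensor_pure_add_cong[OF whittaker_ideal_annihilates[OF hom u] refl])
    then show ?thesis
      by (simp add: left_diff_distrib cscale_mult_left)
  qed
  moreover have "?p u \<in> W \<psi>"
    by (simp add: W_def tensor_product_def tensor_pure_def quotientI)
  ultimately show ?thesis
    by (simp add: whittaker_vector_def W_gen_def W_act_pure W_scale_pure)
qed

lemma commutator_in_ideal_basis:
  assumes "\<And>n. n \<ge> 1 \<Longrightarrow> commutator (L\<^sub>U n) z \<in> whittaker_ideal \<psi>"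
    and "\<And>n. n \<ge> 1 \<Longrightarrow> commutator (M\<^sub>U n) z \<in> whittaker_ideal \<psi>"
    and "\<And>n. n \<ge> 0 \<Longrightarrow> commutator (Y\<^sub>U n) z \<in> whittaker_ideal \<psi>"
  shows "commutator (sv_plus_uea x) z \<in> whittaker_ideal \<psi>"
proof -
  have "commutator (uea_of y) z \<in> whittaker_ideal \<psi>" if "y \<in> sv_plus_space" for y
    using that unfolding sv_plus_space_def
  proof (induction rule: cvec.span_induct_alt)
    case base
    then show ?case
      by (simp add: uea_of_linear commutator_def whittaker_ideal_closure)
  next
    case (step c b y)
    then have "commutator (uea_of b) z \<in> whittaker_ideal \<psi>"
      using assms by auto
    with step show ?case
      by (simp add: uea_of_linear commutator_linear whittaker_ideal_closure)
  qed
  then show ?thesis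
    using Rep_sv_plus[of x] by (simp add: sv_plus_uea_def)
qed

text \<open>Since \<open>z (x - \<psi>(x))\<close> always lies in the ideal, \<open>(x - \<psi>(x)) z\<close> and \<open>[x, z]\<close> agree modulo it, so
  the hypothesis on commutators says that \<open>z\<close> lies in the idealizer.\<close>

lemma whittaker_vector_subalgebra:
  assumes hom: "lie_hom \<psi>"
    and Z: "\<And>x z. z \<in> Z \<Longrightarrow> commutator (sv_plus_uea x) z \<in> whittaker_ideal \<psi>"
    and u: "u \<in> subalgebra_generated Z"
  shows "whittaker_vector \<psi> (W_act \<psi> u (W_gen \<psi>))"
proof (rule whittaker_vectorI[OF hom])
  fix x
  let ?S = "range (\<lambda>x. sv_plus_uea x - \<psi> x *\<^sub>c 1)"
  have "(sv_plus_uea y - \<psi> y *\<^sub>c 1) * z \<in> whittaker_ideal \<psi>" if "z \<in> Z" for y z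
  proof -
    have "(sv_plus_uea y - \<psi> y *\<^sub>c 1) * z
        = commutator (sv_plus_uea y) z + (z * sv_plus_uea y - \<psi> y *\<^sub>c z)"
      by (simp add: commutator_def left_diff_distrib cscale_mult_left)
    also have "\<dots> \<in> whittaker_ideal \<psi>"
      by (intro whittaker_ideal_closure Z that whittaker_ideal_gen)
    finally show ?thesis .
  qed
  moreover have "sv_plus_uea x - \<psi> x *\<^sub>c 1 \<in> left_ideal_generated ?S"
    using left_ideal_generated.mult_gen[of _ ?S 1] by auto
  ultimately show "(sv_plus_uea x - \<psi> x *\<^sub>c 1) * u \<in> whittaker_ideal \<psi>"
    unfolding whittaker_ideal_def by (intro idealizer_subalgebra[OF _ u]) auto
qed

section \<open>Commutators with the cubic element\<close>

lemma commutator_L0: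
  "commutator (L\<^sub>U n) (L\<^sub>U 0) = - (of_int n *\<^sub>c L\<^sub>U n)"
  "commutator (M\<^sub>U n) (L\<^sub>U 0) = - (of_int n *\<^sub>c M\<^sub>U n)"
  "commutator (Y\<^sub>U n) (L\<^sub>U 0) = - ((of_int n + 1 / 2) *\<^sub>c Y\<^sub>U n)"
  by (simp_all add: sv_commutator)

text \<open>The element \<open>z\<close> of the case \<open>\<eta>\<^sub>2 \<noteq> 0 \<or> \<eta>\<^sub>3 \<noteq> 0\<close>; its commutators are computed for arbitrary
  parameters.\<close>

definition whittaker_cubic :: "complex \<Rightarrow> complex \<Rightarrow> complex \<Rightarrow> sv uea" where
  "whittaker_cubic \<eta>\<^sub>1 \<eta>\<^sub>2 \<eta>\<^sub>3 =
     L\<^sub>U 0 * M\<^sub>U 0 ^ 2 - \<eta>\<^sub>2 *\<^sub>c (M\<^sub>U (-2) * M\<^sub>U 0) - \<eta>\<^sub>1 *\<^sub>c (M\<^sub>U (-1) * M\<^sub>U 0)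
     + \<eta>\<^sub>2 *\<^sub>c M\<^sub>U (-1) ^ 2 - (\<eta>\<^sub>3 / 2) *\<^sub>c (Y\<^sub>U (-1) * M\<^sub>U 0) + (\<eta>\<^sub>3\<^sup>2 / 2) *\<^sub>c M\<^sub>U (-1)"

lemma commutator_M0: "commutator (uea_of x) (M\<^sub>U 0) = 0"
  by (simp add: commutator_def M0_central)

lemma commutator_M0_mult:
  "commutator (uea_of x) (M\<^sub>U 0 * a) = M\<^sub>U 0 * commutator (uea_of x) a"
  "commutator (uea_of x) (M\<^sub>U 0 ^ 2 * a) = M\<^sub>U 0 ^ 2 * commutator (uea_of x) a"
  by (simp_all add: commutator_mult commutator_M0 power2_eq_square mult.assoc)

lemma M0_square_central: "uea_of x * M\<^sub>U 0 ^ 2 = M\<^sub>U 0 ^ 2 * uea_of x"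
  by (metis M0_central mult.assoc power2_eq_square)

lemma commutator_M_square:
  "commutator (uea_of x) (M\<^sub>U (-1) ^ 2)
    = commutator (uea_of x) (M\<^sub>U (-1)) * M\<^sub>U (-1) + M\<^sub>U (-1) * commutator (uea_of x) (M\<^sub>U (-1))"
  by (simp add: power2_eq_square commutator_mult)

text \<open>A normal form for commutators: \<open>M\<^sub>0\<close> moves to the far left, so that the factors on which
  \<open>\<psi>\<close> can be evaluated end up on the right.\<close>

lemmas commutator_simps = commutator_linear commutator_M0_mult commutator_M_square sv_commutator
  cscale_mult_left cscale_mult_right cscale_cscale M0_central M0_square_central

lemma commutator_M_cubic:
  "commutator (M\<^sub>U n) (whittaker_cubic \<eta>\<^sub>1 \<eta>\<^sub>2 \<eta>\<^sub>3) = - (of_int n *\<^sub>c (M\<^sub>U 0 ^ 2 * M\<^sub>U n))"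
  unfolding whittaker_cubic_def by (simp add: commutator_simps)

lemma commutator_Y_cubic:
  "commutator (Y\<^sub>U n) (whittaker_cubic \<eta>\<^sub>1 \<eta>\<^sub>2 \<eta>\<^sub>3)
    = (\<eta>\<^sub>3 / 2 * of_int (n + 1)) *\<^sub>c (M\<^sub>U 0 * M\<^sub>U n) - (of_int n + 1 / 2) *\<^sub>c (M\<^sub>U 0 ^ 2 * Y\<^sub>U n)"
  unfolding whittaker_cubic_def by (simp add: commutator_simps algebra_simps add_divide_distrib)

lemma commutator_L_cubic:
  "commutator (L\<^sub>U n) (whittaker_cubic \<eta>\<^sub>1 \<eta>\<^sub>2 \<eta>\<^sub>3)
    = - (of_int n *\<^sub>c (M\<^sub>U 0 ^ 2 * L\<^sub>U n)) + (2 * \<eta>\<^sub>2) *\<^sub>c (M\<^sub>U 0 * M\<^sub>U (n - 2))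
      + \<eta>\<^sub>1 *\<^sub>c (M\<^sub>U 0 * M\<^sub>U (n - 1)) - (2 * \<eta>\<^sub>2) *\<^sub>c (M\<^sub>U (-1) * M\<^sub>U (n - 1))
      + (\<eta>\<^sub>3 / 4 * of_int (n + 1)) *\<^sub>c (M\<^sub>U 0 * Y\<^sub>U (n - 1)) - (\<eta>\<^sub>3\<^sup>2 / 2) *\<^sub>c M\<^sub>U (n - 1)"
proof -
  \<comment> \<open>Collecting like terms needs the scalars split into equal parts.\<close>
  have double: "(\<eta>\<^sub>2 * 2) *\<^sub>c x = \<eta>\<^sub>2 *\<^sub>c x + \<eta>\<^sub>2 *\<^sub>c x" for x :: "sv uea"
    by (metis cscale_add_left mult_2_right)
  have quarter: "(c / 4) *\<^sub>c x = (c / 8) *\<^sub>c x + (c / 8) *\<^sub>c x" for c and x :: "sv uea"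
    by (simp flip: cscale_add_left)
  show ?thesis
    unfolding whittaker_cubic_def
    by (simp add: commutator_simps M_U_commute[of "n - 1" "-1"] algebra_simps add_divide_distrib
        diff_divide_distrib double quarter)
qed

theorem proposition5p1:
  fixes \<psi> :: "sv_plus \<Rightarrow> complex" and \<eta>\<^sub>1 \<eta>\<^sub>2 \<eta>\<^sub>3 :: complex and z u :: "sv uea"
  assumes hom: "lie_hom \<psi>"
    and psi_L: "\<And>n. n \<ge> 3 \<Longrightarrow> \<psi> (Lp n) = 0"
    and psi_M: "\<And>m. m \<ge> 2 \<Longrightarrow> \<psi> (Mp m) = 0"
    and psi_Y: "\<And>k. k \<ge> 1 \<Longrightarrow> \<psi> (Yp k) = 0"
    and psi_M1: "\<psi> (Mp 1) = 0"
    and eta1: "\<eta>\<^sub>1 = \<psi> (Lp 1)"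
    and eta2: "\<eta>\<^sub>2 = \<psi> (Lp 2)"
    and eta3: "\<eta>\<^sub>3 = \<psi> (Yp 0)"
    and z: "z =
      (if \<eta>\<^sub>1 = 0 \<and> \<eta>\<^sub>2 = 0 \<and> \<eta>\<^sub>3 = 0 then L\<^sub>U 0
       else if \<eta>\<^sub>2 \<noteq> 0 \<or> \<eta>\<^sub>3 \<noteq> 0 then
         L\<^sub>U 0 * M\<^sub>U 0 ^ 2 - \<eta>\<^sub>2 *\<^sub>c (M\<^sub>U (-2) * M\<^sub>U 0) - \<eta>\<^sub>1 *\<^sub>c (M\<^sub>U (-1) * M\<^sub>U 0)
         + \<eta>\<^sub>2 *\<^sub>c M\<^sub>U (-1) ^ 2 - (\<eta>\<^sub>3 / 2) *\<^sub>c (Y\<^sub>U (-1) * M\<^sub>U 0) + (\<eta>\<^sub>3\<^sup>2 / 2) *\<^sub>c M\<^sub>U (-1)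
       else L\<^sub>U 0 * M\<^sub>U 0 - \<eta>\<^sub>1 *\<^sub>c M\<^sub>U (-1))"
    and u: "u \<in> subalgebra_generated {z, M\<^sub>U 0}"
  shows "whittaker_vector \<psi> (W_act \<psi> u (W_gen \<psi>))"
proof -
  let ?I = "whittaker_ideal \<psi>"
  have in_M: "a * M\<^sub>U n \<in> ?I" if "n \<ge> 1" for a n
    using whittaker_ideal_basis(2)[OF that, of a \<psi>] psi_M[of n] psi_M1 that
    by (cases "n = 1") auto
  have in_L: "a * L\<^sub>U n - (if n = 1 then \<eta>\<^sub>1 else if n = 2 then \<eta>\<^sub>2 else 0) *\<^sub>c a \<in> ?I"
    if "n \<ge> 1" for a n
    using whittaker_ideal_basis(1)[OF that, of a \<psi>] psi_L[of n] that eta1 eta2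
    by (cases "n = 1"; cases "n = 2") auto
  have in_Y: "a * Y\<^sub>U n - (if n = 0 then \<eta>\<^sub>3 else 0) *\<^sub>c a \<in> ?I" if "n \<ge> 0" for a n
    using whittaker_ideal_basis(3)[OF that, of a \<psi>] psi_Y[of n] that eta3
    by (cases "n = 0") auto
  have L_cubic: "commutator (L\<^sub>U n) (whittaker_cubic \<eta>\<^sub>1 \<eta>\<^sub>2 \<eta>\<^sub>3) \<in> ?I" if n: "n \<ge> 1" for n
  proof -
    consider "n = 1" | "n = 2" | "n \<ge> 3" using n by linarith
    then show ?thesis
    proof cases
      case 1
      \<comment> \<open>The terms in \<open>M\<^bsub>-1\<^esub> M\<^sub>0\<close> cancel; what remains pairs off into two ideal elements.\<close>
      have "commutator (L\<^sub>U 1) (whittaker_cubic \<eta>\<^sub>1 \<eta>\<^sub>2 \<eta>\<^sub>3)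
          = - (M\<^sub>U 0 ^ 2 * L\<^sub>U 1 - \<eta>\<^sub>1 *\<^sub>c M\<^sub>U 0 ^ 2) + (\<eta>\<^sub>3 / 2) *\<^sub>c (M\<^sub>U 0 * Y\<^sub>U 0 - \<eta>\<^sub>3 *\<^sub>c M\<^sub>U 0)"
        unfolding commutator_L_cubic
        by (simp add: M0_central[of "M (-1)"] cvec.scale_right_diff_distrib cscale_cscale power2_eq_square
            cscale_one)
      also have "\<dots> \<in> ?I"
        using in_L[of 1 "M\<^sub>U 0 ^ 2"] in_Y[of 0 "M\<^sub>U 0"]
        by (simp add: whittaker_ideal_closure del: minus_diff_eq)
      finally show ?thesis using 1 by simp
    next
      case 2
      \<comment> \<open>Here \<open>M\<^bsub>-2\<^esub>\<close> becomes \<open>M\<^sub>0\<close> and supplies the \<open>\<eta>\<^sub>2 M\<^sub>0\<^sup>2\<close>; the rest ends in \<open>M\<^sub>1\<close> or \<open>Y\<^bsub>3/2\<^esub>\<close>.\<close>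
      have "commutator (L\<^sub>U 2) (whittaker_cubic \<eta>\<^sub>1 \<eta>\<^sub>2 \<eta>\<^sub>3)
          = - (2 *\<^sub>c (M\<^sub>U 0 ^ 2 * L\<^sub>U 2 - \<eta>\<^sub>2 *\<^sub>c M\<^sub>U 0 ^ 2)) + \<eta>\<^sub>1 *\<^sub>c (M\<^sub>U 0 * M\<^sub>U 1)
            - (2 * \<eta>\<^sub>2) *\<^sub>c (M\<^sub>U (-1) * M\<^sub>U 1) + (3 * \<eta>\<^sub>3 / 4) *\<^sub>c (M\<^sub>U 0 * Y\<^sub>U 1)
            - (\<eta>\<^sub>3\<^sup>2 / 2) *\<^sub>c M\<^sub>U 1"
        unfolding commutator_L_cubic
        by (simp add: cvec.scale_right_diff_distrib cscale_cscale power2_eq_square algebra_simps)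
      also have "\<dots> \<in> ?I"
        using in_L[of 2 "M\<^sub>U 0 ^ 2"] in_Y[of 1 "M\<^sub>U 0"] in_M[of 1 1]
        by (simp add: whittaker_ideal_closure in_M)
      finally show ?thesis using 2 by simp
    next
      case 3
      then show ?thesis
        using in_L[of n "M\<^sub>U 0 ^ 2"] in_Y[of "n - 1" "M\<^sub>U 0"] in_M[of "n - 1" 1]
        unfolding commutator_L_cubic by (simp add: whittaker_ideal_closure in_M)
    qed
  qed
  have M_cubic: "commutator (M\<^sub>U n) (whittaker_cubic \<eta>\<^sub>1 \<eta>\<^sub>2 \<eta>\<^sub>3) \<in> ?I" if "n \<ge> 1" for n
    unfolding commutator_M_cubic by (intro whittaker_ideal_closure in_M that)
  have Y_cubic: "commutator (Y\<^sub>U n) (whittaker_cubic \<eta>\<^sub>1 \<eta>\<^sub>2 \<eta>\<^sub>3) \<in> ?I" if "n \<ge> 0" for n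
  proof (cases "n = 0")
    case True
    have "commutator (Y\<^sub>U 0) (whittaker_cubic \<eta>\<^sub>1 \<eta>\<^sub>2 \<eta>\<^sub>3)
        = - ((1 / 2) *\<^sub>c (M\<^sub>U 0 ^ 2 * Y\<^sub>U 0 - \<eta>\<^sub>3 *\<^sub>c M\<^sub>U 0 ^ 2))"
      unfolding commutator_Y_cubic
      by (simp add: cvec.scale_right_diff_distrib cscale_cscale power2_eq_square)
    also have "\<dots> \<in> ?I"
      using in_Y[of 0 "M\<^sub>U 0 ^ 2"] by (simp add: whittaker_ideal_closure)
    finally show ?thesis using True by simp
  next
    case False
    then show ?thesis
      using that in_Y[of n "M\<^sub>U 0 ^ 2"]
      unfolding commutator_Y_cubic by (simp add: whittaker_ideal_closure in_M)
  qed
  have "commutator (sv_plus_uea x) z \<in> ?I" for x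
  proof -
    consider (trivial) "\<eta>\<^sub>1 = 0" "\<eta>\<^sub>2 = 0" "\<eta>\<^sub>3 = 0" "z = L\<^sub>U 0"
      | (cubic) "z = whittaker_cubic \<eta>\<^sub>1 \<eta>\<^sub>2 \<eta>\<^sub>3"
      | (quadratic) "\<eta>\<^sub>2 = 0" "\<eta>\<^sub>3 = 0" "z = L\<^sub>U 0 * M\<^sub>U 0 - \<eta>\<^sub>1 *\<^sub>c M\<^sub>U (-1)"
      using z by (auto simp: whittaker_cubic_def split: if_splits)
    then show ?thesis
    proof cases
      case trivial
      have "L\<^sub>U n \<in> ?I" if "n \<ge> 1" for n
        using in_L[OF that, of 1] trivial(1,2) by (simp split: if_splits)
      moreover have "M\<^sub>U n \<in> ?I" if "n \<ge> 1" for n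
        using in_M[OF that, of 1] by simp
      moreover have "Y\<^sub>U n \<in> ?I" if "n \<ge> 0" for n
        using in_Y[OF that, of 1] trivial(3) by (simp split: if_splits)
      ultimately show ?thesis
        unfolding trivial(4)
        by (intro commutator_in_ideal_basis) (simp_all add: commutator_L0 whittaker_ideal_closure)
    next
      case cubic
      then show ?thesis
        by (simp add: commutator_in_ideal_basis L_cubic M_cubic Y_cubic)
    next
      case quadratic
      have "commutator (L\<^sub>U n) z \<in> ?I" if "n \<ge> 1" for n
      proof (cases "n = 1")
        case True
        have "commutator (L\<^sub>U 1) z = - (M\<^sub>U 0 * L\<^sub>U 1 - \<eta>\<^sub>1 *\<^sub>c M\<^sub>U 0)"
          unfolding quadratic(3) by (simp add: commutator_simps)
        also have "\<dots> \<in> ?I"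
          using in_L[of 1 "M\<^sub>U 0"]
          by (simp add: whittaker_ideal_closure del: minus_diff_eq)
        finally show ?thesis using True by simp
      next
        case False
        have "commutator (L\<^sub>U n) z = - (of_int n *\<^sub>c (M\<^sub>U 0 * L\<^sub>U n)) + \<eta>\<^sub>1 *\<^sub>c M\<^sub>U (n - 1)"
          unfolding quadratic(3) by (simp add: commutator_simps)
        also have "\<dots> \<in> ?I"
          using False that in_L[of n "M\<^sub>U 0"] in_M[of "n - 1" 1] quadratic(1)
          by (simp add: whittaker_ideal_closure split: if_splits)
        finally show ?thesis .
      qed
      moreover have "commutator (M\<^sub>U n) z \<in> ?I" if "n \<ge> 1" for n
        using in_M[OF that, of "M\<^sub>U 0"] unfolding quadratic(3)
        by (simp add: commutator_simps whittaker_ideal_closure)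
      moreover have "commutator (Y\<^sub>U n) z \<in> ?I" if "n \<ge> 0" for n
      proof -
        have "commutator (Y\<^sub>U n) z = - ((of_int n + 1 / 2) *\<^sub>c (M\<^sub>U 0 * Y\<^sub>U n))"
          unfolding quadratic(3) by (simp add: commutator_simps)
        also have "\<dots> \<in> ?I"
          using in_Y[OF that, of "M\<^sub>U 0"] quadratic(2)
          by (simp add: whittaker_ideal_closure split: if_splits)
        finally show ?thesis .
      qed
      ultimately show ?thesis
        by (rule commutator_in_ideal_basis)
    qed
  qed
  moreover have "commutator (sv_plus_uea x) (M\<^sub>U 0) \<in> ?I" for x
    by (simp add: commutator_def sv_plus_uea_def M0_central whittaker_ideal_closure)
  ultimately show ?thesis
    using u by (intro whittaker_vector_subalgebra[OF hom]) auto
qed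

end
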